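(* Let $n\ge 1$ and let $X_1,\dots,X_n$ be independent random variables such that, for each $i$, $\mathbb P(X_i=\tfrac12)=T_i$, $\mathbb P(X_i=1)=W_i$, and $\mathbb P(X_i=0)=L_i:=1-T_i-W_i$, where $T_i,W_i,L_i\ge 0$. Let $X=\sum_{i=1}^n X_i$. Suppose that $\mathbb P(X\in\mathbb Z)=0$ or $\mathbb P(X\in\mathbb Z+\tfrac12)=0$. Then $T_i\in\{0,1\}$ for $i=1,\dots,n$, and if $k$ is the number of indices $i$ with $T_i=0$, then the distribution of $X$ is the Poisson binomial distribution with the $k$ success probabilities $W_i$, for those $i$ with $T_i=0$, shifted to the right by $\tfrac{n-k}{2}$.
   Context: The Poisson binomial distribution with success probabilities $p_1,\dots,p_k\in[0,1]$ is the distribution of a sum of $k$ independent Bernoulli random variables with success probabilities $p_1,\dots,p_k$ (for $k=0$ it is the point mass at $0$). A distribution shifted to the right by $c$ is the law of $B+c$, where $B$ has the given distribution. *)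

theory Defs
  imports "HOL-Probability.Probability"
begin

(* The number of successes among independent Bernoulli trials indexed by the finite set I.
   The index set, rather than a list, carries the multiset of success probabilities.
   bernoulli_pmf truncates its parameter to [0,1], so only p i in [0,1] is meaningful. *)
definition poisson_binomial_pmf :: "'i set \<Rightarrow> ('i \<Rightarrow> real) \<Rightarrow> nat pmf" where
  "poisson_binomial_pmf I p =
     map_pmf (\<lambda>b. \<Sum>i\<in>I. of_bool (b i)) (Pi_pmf I False (\<lambda>i. bernoulli_pmf (p i)))"

(* The law of B + c on the Borel sets of the reals, where B has distribution D. *)
definition shifted_law :: "real \<Rightarrow> nat pmf \<Rightarrow> real measure" where
  "shifted_law c D = distr (measure_pmf D) borel (\<lambda>b. real b + c)"

lemma poisson_binomial_pmf_empty: "poisson_binomial_pmf {} p = return_pmf 0"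
  by (simp add: poisson_binomial_pmf_def)

end

theory Submission
  imports Defs
begin

text \<open>
  Doubling turns the three values into the integers \<open>0\<close>, \<open>1\<close>, \<open>2\<close>, so whether the sum of the \<open>X i\<close> is an integer
  depends only on the parity of the number of indices with \<open>X i = 1/2\<close>.  That parity is recorded by
  the product of the independent signs \<open>\<plusminus>1\<close>, where the sign of \<open>i\<close> is \<open>-1\<close> exactly if
  \<open>X i = 1/2\<close>.  The sign of \<open>i\<close> has mean \<open>1 - 2 * T i\<close>, hence the product has mean
  \<open>\<Prod>i. 1 - 2 * T i\<close>.  If one of the two cosets of the integers has probability zero, the parity is
  almost surely constant, so this product of numbers in \<open>[-1, 1]\<close> is \<open>1\<close> or \<open>-1\<close>.  Then no factor can
  lie strictly between \<open>-1\<close> and \<open>1\<close>, that is, \<open>T i \<in> {0, 1}\<close> for every \<open>i\<close>; this is lemma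
  \<open>half_probabilities_degenerate\<close>.

  Consequently the indices with \<open>T i = 1\<close> contribute the constant \<open>1/2\<close> each, and for the remaining
  indices \<open>X i\<close> is almost surely the indicator of \<open>X i = 1\<close>.  These indicators are independent
  Bernoulli variables with parameters \<open>W i\<close>.  Such variables have the same joint law as the
  coordinates of the product of Bernoulli distributions from which the Poisson binomial
  distribution is built (\<open>joint_law_eq_Pi_pmf\<close>), hence their sum has the Poisson binomial law
  (\<open>shifted_bernoulli_sum_law\<close>).
\<close>

section \<open>Independent discrete variables and product distributions\<close>

text \<open>
  Independence makes the joint law on the left a product measure, and the coordinates of a
  product distribution are independent as well, so both sides are the product of the marginals.
\<close>

lemma (in prob_space) joint_law_eq_Pi_pmf:
  fixes B :: "'i \<Rightarrow> 'a \<Rightarrow> 'b"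
  assumes "finite J" "J \<noteq> {}"
    and indep: "indep_vars (\<lambda>_. count_space UNIV) B J"
    and marginal: "\<And>i. i \<in> J \<Longrightarrow> distr M (count_space UNIV) (B i) = measure_pmf (q i)"
  shows "distr M (PiM J (\<lambda>_. count_space UNIV)) (\<lambda>\<omega>. \<lambda>i\<in>J. B i \<omega>)
       = distr (measure_pmf (Pi_pmf J d q)) (PiM J (\<lambda>_. count_space UNIV)) (\<lambda>f. \<lambda>i\<in>J. f i)"
proof -
  have "distr M (PiM J (\<lambda>_. count_space UNIV)) (\<lambda>\<omega>. \<lambda>i\<in>J. B i \<omega>)
      = PiM J (\<lambda>i. distr M (count_space UNIV) (B i))"
    using indep indep_vars_iff_distr_eq_PiM'[OF \<open>J \<noteq> {}\<close>, of B "\<lambda>_. count_space UNIV"]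
    by (auto simp: indep_vars_def)
  also have "\<dots> = PiM J (\<lambda>i. distr (measure_pmf (Pi_pmf J d q)) (count_space UNIV) (\<lambda>f. f i))"
  proof (rule PiM_cong)
    fix i assume "i \<in> J"
    have "distr (measure_pmf (Pi_pmf J d q)) (count_space UNIV) (\<lambda>f. f i)
        = measure_pmf (map_pmf (\<lambda>f. f i) (Pi_pmf J d q))"
      by (simp add: map_pmf_rep_eq)
    also have "\<dots> = measure_pmf (q i)"
      using \<open>finite J\<close> \<open>i \<in> J\<close> by (simp add: Pi_pmf_component)
    finally show "distr M (count_space UNIV) (B i)
        = distr (measure_pmf (Pi_pmf J d q)) (count_space UNIV) (\<lambda>f. f i)"
      using marginal[OF \<open>i \<in> J\<close>] by simp
  qed simp
  also have "\<dots> = distr (measure_pmf (Pi_pmf J d q)) (PiM J (\<lambda>_. count_space UNIV))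
                     (\<lambda>f. \<lambda>i\<in>J. f i)"
    using indep_vars_Pi_pmf[OF \<open>finite J\<close>, of d q]
      prob_space.indep_vars_iff_distr_eq_PiM'[OF measure_pmf.prob_space_axioms \<open>J \<noteq> {}\<close>,
        of "\<lambda>i f. f i" "Pi_pmf J d q" "\<lambda>_. count_space UNIV"]
    by simp
  finally show ?thesis .
qed

lemma (in prob_space) distr_bool_eq_bernoulli:
  assumes "B \<in> measurable M (count_space UNIV)"
  shows "distr M (count_space UNIV) B = measure_pmf (bernoulli_pmf (prob {\<omega> \<in> space M. B \<omega>}))"
proof (rule measure_eqI_countable[where A = UNIV])
  fix b :: bool
  have ev: "{\<omega> \<in> space M. B \<omega>} \<in> events"
    using assms by measurable
  have "prob (B -` {b} \<inter> space M) = pmf (bernoulli_pmf (prob {\<omega> \<in> space M. B \<omega>})) b"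
  proof (cases b)
    case True
    then have "B -` {b} \<inter> space M = {\<omega> \<in> space M. B \<omega>}" by auto
    with True show ?thesis by simp
  next
    case False
    then have "B -` {b} \<inter> space M = space M - {\<omega> \<in> space M. B \<omega>}" by auto
    with False show ?thesis using prob_compl[OF ev] by simp
  qed
  then show "emeasure (distr M (count_space UNIV) B) {b}
      = emeasure (measure_pmf (bernoulli_pmf (prob {\<omega> \<in> space M. B \<omega>}))) {b}"
    using assms by (simp add: emeasure_distr emeasure_eq_measure emeasure_pmf_single)
qed auto

text \<open>
  The sum is the same function of the joint vector on both probability spaces.  The vector is
  viewed in the finite product \<open>PiM J\<close>, where the sum is measurable and the two joint laws agree.
\<close>

lemma (in prob_space) shifted_bernoulli_sum_law:
  assumes "finite J"
    and indep: "indep_vars (\<lambda>_. count_space UNIV) B J"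
  shows "distr M borel (\<lambda>\<omega>. (\<Sum>i\<in>J. of_bool (B i \<omega>)) + c)
       = shifted_law c (poisson_binomial_pmf J (\<lambda>i. prob {\<omega> \<in> space M. B i \<omega>}))"
proof (cases "J = {}")
  case True
  then show ?thesis
    by (simp add: poisson_binomial_pmf_empty shifted_law_def return_pmf.rep_eq distr_return)
next
  case False
  define P where "P = PiM J (\<lambda>_. count_space (UNIV :: bool set))"
  define q where "q = (\<lambda>i. bernoulli_pmf (prob {\<omega> \<in> space M. B i \<omega>}))"
  define h where "h = (\<lambda>f. (\<Sum>i\<in>J. of_bool (f i)) + c)"
  have B: "B i \<in> measurable M (count_space UNIV)" if "i \<in> J" for i
    using indep that by (auto simp: indep_vars_def)
  have h: "h \<in> borel_measurable P"
  proof -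
    have "(\<lambda>f. of_bool (f i) :: real) \<in> borel_measurable P" if "i \<in> J" for i
    proof (rule measurable_compose[where N = "count_space UNIV" and g = of_bool])
      show "(\<lambda>f. f i) \<in> measurable P (count_space UNIV)"
        unfolding P_def using that by (rule measurable_component_singleton)
    qed simp
    then show ?thesis unfolding h_def by measurable
  qed
  have restr_B: "(\<lambda>\<omega>. \<lambda>i\<in>J. B i \<omega>) \<in> measurable M P"
    unfolding P_def using B by (intro measurable_restrict)
  have restr_pmf: "(\<lambda>f. \<lambda>i\<in>J. f i) \<in> measurable (measure_pmf (Pi_pmf J False q)) P"
    unfolding P_def by (intro measurable_restrict) simp
  have "distr M borel (\<lambda>\<omega>. (\<Sum>i\<in>J. of_bool (B i \<omega>)) + c)
      = distr (distr M P (\<lambda>\<omega>. \<lambda>i\<in>J. B i \<omega>)) borel h"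
    by (subst distr_distr[OF h restr_B]) (simp add: h_def comp_def)
  also have "distr M P (\<lambda>\<omega>. \<lambda>i\<in>J. B i \<omega>)
      = distr (measure_pmf (Pi_pmf J False q)) P (\<lambda>f. \<lambda>i\<in>J. f i)"
    unfolding P_def q_def
    by (intro joint_law_eq_Pi_pmf assms False distr_bool_eq_bernoulli B)
  also have "distr \<dots> borel h = distr (measure_pmf (Pi_pmf J False q)) borel h"
    by (subst distr_distr[OF h restr_pmf]) (simp add: h_def comp_def)
  also have "\<dots> = shifted_law c (poisson_binomial_pmf J (\<lambda>i. prob {\<omega> \<in> space M. B i \<omega>}))"
    by (simp add: shifted_law_def poisson_binomial_pmf_def map_pmf_rep_eq distr_distr
        comp_def h_def q_def)
  finally show ?thesis .
qed

section \<open>The parity of the number of halves\<close>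

text \<open>
  The product is \<open>(-1) ^ h\<close>, where \<open>h\<close> is the number of halves.  The disjunction, rather than an
  equivalence, is the form from which an almost sure value of the sign is read off once one of
  the two cosets is excluded.
\<close>

lemma sum_half_integers_parity:
  fixes x :: "'i \<Rightarrow> real"
  assumes "finite J" "\<And>i. i \<in> J \<Longrightarrow> x i \<in> {0, 1/2, 1}"
  shows "((\<Prod>i\<in>J. if x i = 1/2 then -1 else 1 :: real) = 1 \<and> (\<Sum>i\<in>J. x i) \<in> \<int>)
       \<or> ((\<Prod>i\<in>J. if x i = 1/2 then -1 else 1 :: real) = -1 \<and> (\<Sum>i\<in>J. x i) \<in> (\<lambda>z. z + 1/2) ` \<int>)"
  using assms
proof (induction J rule: finite_induct)
  case empty
  then show ?case by simp
next
  case (insert j J)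
  have coset: "y \<in> (\<lambda>z. z + 1/2) ` \<int> \<longleftrightarrow> y - 1/2 \<in> \<int>" for y :: real
    by (auto simp: image_iff intro!: bexI[of _ "y - 1/2"])
  define s where "s = (\<Sum>i\<in>J. x i)"
  define p where "p = (\<Prod>i\<in>J. if x i = 1/2 then -1 else 1 :: real)"
  have IH: "(p = 1 \<and> s \<in> \<int>) \<or> (p = -1 \<and> s - 1/2 \<in> \<int>)"
    using insert unfolding p_def s_def coset by simp
  have halves: "1/2 + s \<in> \<int>" if "s - 1/2 \<in> \<int>"
    using Ints_add[OF that Ints_1] by (simp add: add.commute)
  have shift: "1 + s \<in> \<int>" if "s \<in> \<int>"
    using that by simp
  have shift': "1 + s - 1/2 \<in> \<int>" if "s - 1/2 \<in> \<int>"
    using Ints_add[OF that Ints_1] by (simp add: algebra_simps)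
  have "x j \<in> {0, 1/2, 1}" using insert.prems by simp
  then consider "x j = 0" | "x j = 1/2" | "x j = 1" by blast
  then have "((if x j = 1/2 then -1 else 1) * p = 1 \<and> x j + s \<in> \<int>)
      \<or> ((if x j = 1/2 then -1 else 1) * p = -1 \<and> x j + s - 1/2 \<in> \<int>)"
  proof cases
    case 1
    show ?thesis unfolding 1 using IH by auto
  next
    case 2
    show ?thesis unfolding 2 using IH halves by auto
  next
    case 3
    show ?thesis unfolding 3 using IH shift shift' by auto
  qed
  then show ?case
    unfolding coset sum.insert[OF insert.hyps] prod.insert[OF insert.hyps] s_def p_def .
qed

lemma factors_pm_one_of_prod:
  fixes f :: "'i \<Rightarrow> real"
  assumes "finite J" "\<And>i. i \<in> J \<Longrightarrow> \<bar>f i\<bar> \<le> 1" "\<bar>\<Prod>i\<in>J. f i\<bar> = 1" "i \<in> J"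
  shows "\<bar>f i\<bar> = 1"
proof -
  have "1 = \<bar>f i\<bar> * (\<Prod>j\<in>J - {i}. \<bar>f j\<bar>)"
    using assms prod.remove[of J i "\<lambda>j. \<bar>f j\<bar>"] by (simp add: abs_prod)
  also have "\<dots> \<le> \<bar>f i\<bar> * 1"
    using assms by (intro mult_left_mono prod_le_1) auto
  finally show ?thesis using assms(2)[OF assms(4)] by simp
qed

text \<open>
  The sign product is almost surely a constant of absolute value one, and by independence that
  constant is the product of the means \<open>1 - 2 * prob {X i = 1/2}\<close> of the signs, each of which lies
  in \<open>[-1, 1]\<close>.
\<close>

lemma (in prob_space) half_probabilities_degenerate:
  fixes X :: "'i \<Rightarrow> 'a \<Rightarrow> real"
  assumes "finite J"
    and indep: "indep_vars (\<lambda>_. borel) X J"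
    and support: "\<And>i. i \<in> J \<Longrightarrow> AE \<omega> in M. X i \<omega> \<in> {0, 1/2, 1}"
    and lattice: "prob {\<omega> \<in> space M. (\<Sum>i\<in>J. X i \<omega>) \<in> \<int>} = 0
       \<or> prob {\<omega> \<in> space M. (\<Sum>i\<in>J. X i \<omega>) \<in> (\<lambda>z. z + 1/2) ` \<int>} = 0"
    and "i \<in> J"
  shows "prob {\<omega> \<in> space M. X i \<omega> = 1/2} \<in> {0, 1}"
proof -
  define \<sigma> where "\<sigma> = (\<lambda>x :: real. if x = 1/2 then -1 else 1 :: real)"
  have \<sigma>: "\<sigma> \<in> borel_measurable borel"
    unfolding \<sigma>_def by measurable
  have X: "X j \<in> borel_measurable M" if "j \<in> J" for j
    using indep that by (auto simp: indep_vars_def)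
  have sum_meas: "(\<lambda>\<omega>. \<Sum>i\<in>J. X i \<omega>) \<in> borel_measurable M"
    using X by measurable
  have ints: "(\<int> :: real set) \<in> sets borel" "(\<lambda>z. z + 1/2) ` (\<int> :: real set) \<in> sets borel"
  proof -
    have "A \<in> sets borel" if "countable A" for A :: "real set"
      by (rule sets.countable[OF _ that]) simp
    moreover have "countable (\<int> :: real set)"
      unfolding Ints_def by simp
    ultimately show "(\<int> :: real set) \<in> sets borel" "(\<lambda>z. z + 1/2) ` (\<int> :: real set) \<in> sets borel"
      by auto
  qed
  have null: "AE \<omega> in M. (\<Sum>i\<in>J. X i \<omega>) \<notin> A"
    if "prob {\<omega> \<in> space M. (\<Sum>i\<in>J. X i \<omega>) \<in> A} = 0" "A \<in> sets borel" for A
  proof -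
    have "{\<omega> \<in> space M. (\<Sum>i\<in>J. X i \<omega>) \<in> A} \<in> events"
      using sum_meas that(2) by measurable
    with that(1) show ?thesis by (subst (asm) prob_eq_0) auto
  qed
  have mean: "expectation (\<lambda>\<omega>. \<sigma> (X j \<omega>)) = 1 - 2 * prob {\<omega> \<in> space M. X j \<omega> = 1/2}"
    if "j \<in> J" for j
  proof -
    have ev: "{\<omega> \<in> space M. X j \<omega> = 1/2} \<in> events"
      using X[OF that] by measurable
    have "expectation (\<lambda>\<omega>. \<sigma> (X j \<omega>))
        = expectation (\<lambda>\<omega>. 1 - 2 * indicator {\<omega> \<in> space M. X j \<omega> = 1/2} \<omega>)"
      by (intro Bochner_Integration.integral_cong) (auto simp: \<sigma>_def)
    also have "\<dots> = 1 - 2 * prob {\<omega> \<in> space M. X j \<omega> = 1/2}"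
      using ev by (simp add: prob_space emeasure_eq_measure Bochner_Integration.integral_diff)
    finally show ?thesis .
  qed
  have "indep_vars (\<lambda>_. borel) (\<lambda>j \<omega>. \<sigma> (X j \<omega>)) J"
    using indep \<sigma> by (rule indep_vars_compose2)
  moreover have "integrable M (\<lambda>\<omega>. \<sigma> (X j \<omega>))" if "j \<in> J" for j
    using measurable_compose[OF X[OF that] \<sigma>]
    by (intro integrable_const_bound[where B = 1]) (auto simp: \<sigma>_def)
  ultimately have "expectation (\<lambda>\<omega>. \<Prod>j\<in>J. \<sigma> (X j \<omega>)) = (\<Prod>j\<in>J. expectation (\<lambda>\<omega>. \<sigma> (X j \<omega>)))"
    using \<open>finite J\<close> by (intro indep_vars_lebesgue_integral)
  then have prod_mean: "expectation (\<lambda>\<omega>. \<Prod>j\<in>J. \<sigma> (X j \<omega>))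
      = (\<Prod>j\<in>J. 1 - 2 * prob {\<omega> \<in> space M. X j \<omega> = 1/2})"
    using mean by simp
  have prod_meas: "(\<lambda>\<omega>. \<Prod>j\<in>J. \<sigma> (X j \<omega>)) \<in> borel_measurable M"
    using measurable_compose[OF X \<sigma>] by (intro borel_measurable_prod)
  have all_values: "AE \<omega> in M. \<forall>j\<in>J. X j \<omega> \<in> {0, 1/2, 1}"
    using \<open>finite J\<close> support by (intro eventually_ball_finite ballI)
  obtain e where e: "\<bar>e\<bar> = 1" "AE \<omega> in M. (\<Prod>j\<in>J. \<sigma> (X j \<omega>)) = e"
  proof (cases "prob {\<omega> \<in> space M. (\<Sum>i\<in>J. X i \<omega>) \<in> \<int>} = 0")
    case True
    from all_values null[OF True ints(1)] have "AE \<omega> in M. (\<Prod>j\<in>J. \<sigma> (X j \<omega>)) = -1"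
    proof eventually_elim
      case (elim \<omega>)
      then show ?case
        using sum_half_integers_parity[OF \<open>finite J\<close>, of "\<lambda>j. X j \<omega>"] unfolding \<sigma>_def by blast
    qed
    then show ?thesis by (intro that[of "-1"]) auto
  next
    case False
    with lattice have "prob {\<omega> \<in> space M. (\<Sum>i\<in>J. X i \<omega>) \<in> (\<lambda>z. z + 1/2) ` \<int>} = 0" by blast
    from all_values null[OF this ints(2)] have "AE \<omega> in M. (\<Prod>j\<in>J. \<sigma> (X j \<omega>)) = 1"
    proof eventually_elim
      case (elim \<omega>)
      then show ?case
        using sum_half_integers_parity[OF \<open>finite J\<close>, of "\<lambda>j. X j \<omega>"] unfolding \<sigma>_def by blast
    qed
    then show ?thesis by (intro that[of 1]) auto
  qed
  have "expectation (\<lambda>\<omega>. \<Prod>j\<in>J. \<sigma> (X j \<omega>)) = expectation (\<lambda>_. e)"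
    using e(2) prod_meas by (intro integral_cong_AE) auto
  then have "\<bar>\<Prod>j\<in>J. 1 - 2 * prob {\<omega> \<in> space M. X j \<omega> = 1/2}\<bar> = 1"
    using e(1) prod_mean by (simp add: prob_space)
  moreover have "\<bar>1 - 2 * prob {\<omega> \<in> space M. X j \<omega> = 1/2}\<bar> \<le> 1" for j
    using prob_le_1[of "{\<omega> \<in> space M. X j \<omega> = 1/2}"]
      measure_nonneg[of M "{\<omega> \<in> space M. X j \<omega> = 1/2}"] by linarith
  ultimately have "\<bar>1 - 2 * prob {\<omega> \<in> space M. X i \<omega> = 1/2}\<bar> = 1"
    using \<open>finite J\<close> \<open>i \<in> J\<close>
    by (intro factors_pm_one_of_prod[where f = "\<lambda>j. 1 - 2 * prob {\<omega> \<in> space M. X j \<omega> = 1/2}"]) auto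
  then show ?thesis by (auto simp: abs_if split: if_splits)
qed

section \<open>The law of the sum\<close>

lemma (in prob_space) AE_three_values:
  fixes Y :: "'a \<Rightarrow> real"
  assumes Y: "Y \<in> borel_measurable M" and "a \<noteq> b" "b \<noteq> c" "a \<noteq> c"
    and sum: "prob {\<omega> \<in> space M. Y \<omega> = a} + prob {\<omega> \<in> space M. Y \<omega> = b}
        + prob {\<omega> \<in> space M. Y \<omega> = c} = 1"
  shows "AE \<omega> in M. Y \<omega> \<in> {a, b, c}"
proof -
  have ev: "{\<omega> \<in> space M. Y \<omega> = v} \<in> events" for v
    using Y by measurable
  have "prob ({\<omega> \<in> space M. Y \<omega> = a} \<union> {\<omega> \<in> space M. Y \<omega> = b} \<union> {\<omega> \<in> space M. Y \<omega> = c}) = 1"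
    using assms(2-4) ev sum
    by (subst finite_measure_Union, auto)+
  moreover have "{\<omega> \<in> space M. Y \<omega> = a} \<union> {\<omega> \<in> space M. Y \<omega> = b} \<union> {\<omega> \<in> space M. Y \<omega> = c}
      = {\<omega> \<in> space M. Y \<omega> \<in> {a, b, c}}" by auto
  ultimately have "prob {\<omega> \<in> space M. Y \<omega> \<in> {a, b, c}} = 1" by simp
  then show ?thesis
    using Y by (subst (asm) prob_Collect_eq_1) auto
qed

theorem theorem2:
  fixes M :: "'a measure" and n :: nat and X :: "nat \<Rightarrow> 'a \<Rightarrow> real"
    and T W L :: "nat \<Rightarrow> real"
  defines "S \<equiv> \<lambda>\<omega>. \<Sum>i\<in>{1..n}. X i \<omega>"
  assumes "prob_space M"
    and "n \<ge> 1"
    and "prob_space.indep_vars M (\<lambda>_. borel) X {1..n}"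
    and "\<And>i. i \<in> {1..n} \<Longrightarrow> L i = 1 - T i - W i"
    and "\<And>i. i \<in> {1..n} \<Longrightarrow> T i \<ge> 0 \<and> W i \<ge> 0 \<and> L i \<ge> 0"
    and "\<And>i. i \<in> {1..n} \<Longrightarrow> measure M {\<omega> \<in> space M. X i \<omega> = 1/2} = T i"
    and "\<And>i. i \<in> {1..n} \<Longrightarrow> measure M {\<omega> \<in> space M. X i \<omega> = 1} = W i"
    and "\<And>i. i \<in> {1..n} \<Longrightarrow> measure M {\<omega> \<in> space M. X i \<omega> = 0} = L i"
    and "measure M {\<omega> \<in> space M. S \<omega> \<in> \<int>} = 0
       \<or> measure M {\<omega> \<in> space M. S \<omega> \<in> (\<lambda>z. z + 1/2) ` \<int>} = 0"
  shows "(\<forall>i\<in>{1..n}. T i \<in> {0, 1}) \<and>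
    (\<forall>k. k = card {i \<in> {1..n}. T i = 0} \<longrightarrow>
       distr M borel S =
         shifted_law ((real n - real k) / 2) (poisson_binomial_pmf {i \<in> {1..n}. T i = 0} W))"
proof -
  interpret prob_space M by fact
  note indep = assms(4) and L = assms(5) and nonneg = assms(6)
    and prob_half = assms(7) and prob_one = assms(8) and prob_zero = assms(9)
  have X: "X i \<in> borel_measurable M" if "i \<in> {1..n}" for i
    using indep that by (auto simp: indep_vars_def)
  have support: "AE \<omega> in M. X i \<omega> \<in> {0, 1/2, 1}" if "i \<in> {1..n}" for i
    using that X[OF that] L[OF that] prob_half[OF that] prob_one[OF that] prob_zero[OF that]
    by (intro AE_three_values) auto
  have T01: "T i \<in> {0, 1}" if "i \<in> {1..n}" for i
    using half_probabilities_degenerate[OF _ indep support _ that] assms(10) prob_half[OF that]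
    by (simp add: S_def)
  define J where "J = {i \<in> {1..n}. T i = 0}"
  define B where "B = (\<lambda>i \<omega>. X i \<omega> = 1)"
  have J: "J \<subseteq> {1..n}" "finite J" by (auto simp: J_def)
  have indep_B: "indep_vars (\<lambda>_. count_space UNIV) B J"
    unfolding B_def
    by (rule indep_vars_compose2[OF indep_vars_subset[OF indep J(1)]]) measurable
  have term_value: "AE \<omega> in M. X i \<omega> = (if i \<in> J then of_bool (B i \<omega>) else 1/2)"
    if i: "i \<in> {1..n}" for i
  proof (cases "i \<in> J")
    case True
    have "AE \<omega> in M. X i \<omega> \<noteq> 1/2"
      using True X[OF i] prob_half[OF i] by (subst prob_Collect_eq_0[symmetric]) (auto simp: J_def)
    with support[OF i] show ?thesis
      by eventually_elim (use True in \<open>auto simp: B_def\<close>)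
  next
    case False
    with T01[OF i] i have "T i = 1" by (auto simp: J_def)
    then have "AE \<omega> in M. X i \<omega> = 1/2"
      using X[OF i] prob_half[OF i] by (subst prob_Collect_eq_1[symmetric]) auto
    with False show ?thesis by simp
  qed
  (* Each of the n - card J indices outside J contributes exactly 1/2. *)
  define c where "c = (real n - real (card J)) / 2"
  have "AE \<omega> in M. \<forall>i\<in>{1..n}. X i \<omega> = (if i \<in> J then of_bool (B i \<omega>) else 1/2)"
    using term_value by (intro eventually_ball_finite ballI finite_atLeastAtMost)
  then have "AE \<omega> in M. S \<omega> = (\<Sum>i\<in>J. of_bool (B i \<omega>)) + c"
  proof eventually_elim
    case (elim \<omega>)
    have "S \<omega> = (\<Sum>i\<in>{1..n}. if i \<in> J then of_bool (B i \<omega>) else 1/2)"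
      unfolding S_def using elim by (intro sum.cong) auto
    also have "\<dots> = (\<Sum>i\<in>J. of_bool (B i \<omega>)) + (\<Sum>i\<in>{1..n} - J. 1/2)"
      using J by (simp add: sum.If_cases Int_absorb1 Diff_eq)
    also have "(\<Sum>i\<in>{1..n} - J. 1/2 :: real) = c"
      using J card_mono[OF _ J(1)] by (simp add: c_def card_Diff_subset of_nat_diff)
    finally show ?case .
  qed
  moreover have "S \<in> borel_measurable M"
    unfolding S_def using X by measurable
  moreover have "(\<lambda>\<omega>. (\<Sum>i\<in>J. of_bool (B i \<omega>)) + c) \<in> borel_measurable M"
  proof -
    have "(\<lambda>\<omega>. of_bool (B i \<omega>) :: real) \<in> borel_measurable M" if "i \<in> J" for i
    proof (rule measurable_compose[where N = "count_space UNIV" and g = of_bool])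
      show "B i \<in> measurable M (count_space UNIV)"
        using indep_B that by (auto simp: indep_vars_def)
    qed simp
    then show ?thesis by measurable
  qed
  ultimately have "distr M borel S = distr M borel (\<lambda>\<omega>. (\<Sum>i\<in>J. of_bool (B i \<omega>)) + c)"
    by (intro distr_cong_AE) auto
  also have "\<dots> = shifted_law c (poisson_binomial_pmf J (\<lambda>i. prob {\<omega> \<in> space M. B i \<omega>}))"
    using J(2) indep_B by (rule shifted_bernoulli_sum_law)
  also have "poisson_binomial_pmf J (\<lambda>i. prob {\<omega> \<in> space M. B i \<omega>}) = poisson_binomial_pmf J W"
    unfolding poisson_binomial_pmf_def B_def
    using J prob_one by (intro arg_cong[where f = "map_pmf _"] Pi_pmf_cong) auto
  finally have "distr M borel S = shifted_law c (poisson_binomial_pmf J W)" .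
  then show ?thesis
    using T01 by (auto simp: c_def J_def)
qed

end
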